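(* Let $P$ be the true transition kernel of a discounted MDP on a metric state space $(\mathscr S,d)$ with discount $\gamma\in(0,1)$, let $\hat P$ be a simulator kernel, and let $\Pi$ be a class of policies. Assume that $V_\pi^{\hat P}$ is $L_v$-Lipschitz on $(\mathscr S,d)$ for all $\pi\in\Pi$. Let $M_{\mathrm{err}}$ be the Error-MDP with the same state space, action space and true transition kernel $P$ and with reward $r_{\mathrm{err}}(s,a)=W_1(P(\cdot\mid s,a),\hat P(\cdot\mid s,a))$, and let $V^*(M_{\mathrm{err}})=\sup_{\pi\in\Pi}V_\pi(M_{\mathrm{err}})$ be its optimal value. Then $$\sup_{\pi\in\Pi}|V_\pi(P)-V_\pi(\hat P)|\le\gamma\,L_v\,V^*(M_{\mathrm{err}}).$$
   Context: An MDP has state space $\mathscr S$, action space $\mathscr A$, transition kernel $P(\cdot\mid s,a)$, known reward $r(s,a)\in[0,R_{\max}]$, discount $\gamma\in(0,1)$ and initial state law $\rho_0$. For a kernel $Q$ and policy $\pi$, $V_\pi^{Q}(s)=\mathbb E[\sum_{t\ge0}\gamma^t r(s_t,a_t)\mid s_0=s]$ when actions follow $\pi$ and transitions follow $Q$, and $V_\pi(Q)=\mathbb E_{s_0\sim\rho_0}[V_\pi^Q(s_0)]$. $d_\pi(s,a)=\mathbb E[\sum_{t\ge0}\gamma^t\mathbf 1\{(s_t,a_t)=(s,a)\}]$ is the unnormalized discounted occupancy of $\pi$ under the true kernel $P$ started from $\rho_0$, and $\mathbb E_{(s,a)\sim d_\pi}$ denotes unnormalized summation (integration) against $d_\pi$.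 $W_1$ is the 1-Wasserstein distance on $(\mathscr S,d)$. The value of $\pi$ in the Error-MDP is its expected unnormalized discounted return $V_\pi(M_{\mathrm{err}})=\mathbb E_{(s,a)\sim d_\pi}[r_{\mathrm{err}}(s,a)]$. *)

theory Defs
  imports "HOL-Probability.Probability"
begin

text \<open>
  The state space is the whole type \<open>'s\<close>, of class \<^class>\<open>metric_space\<close>, with its Borel
  sigma-algebra; the action space is an arbitrary measurable space \<open>A\<close>. Kernels and policies are
  measurable maps into spaces of probability measures.
\<close>

type_synonym ('s, 'a) kernel = "'s \<times> 'a \<Rightarrow> 's measure"
type_synonym ('s, 'a) policy = "'s \<Rightarrow> 'a measure"

abbreviation state_action :: "'a measure \<Rightarrow> ('s::topological_space \<times> 'a) measure" where
  "state_action A \<equiv> borel \<Otimes>\<^sub>M A"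

abbreviation kernels :: "'a measure \<Rightarrow> ('s::topological_space, 'a) kernel set" where
  "kernels A \<equiv> state_action A \<rightarrow>\<^sub>M prob_algebra borel"

abbreviation policies :: "'a measure \<Rightarrow> ('s::topological_space, 'a) policy set" where
  "policies A \<equiv> borel \<rightarrow>\<^sub>M prob_algebra A"

definition with_action ::
    "'a measure \<Rightarrow> ('s::topological_space, 'a) policy \<Rightarrow> 's \<Rightarrow> ('s \<times> 'a) measure" where
  "with_action A \<pi> s = distr (\<pi> s) (state_action A) (Pair s)"

text \<open>Conditional law of \<open>(s\<^sub>n, a\<^sub>n)\<close> given the history \<open>\<omega>\<close> of state-action pairs before time \<open>n\<close>.\<close>

primrec step_law ::
    "'a measure \<Rightarrow> 's measure \<Rightarrow> ('s::topological_space, 'a) kernel \<Rightarrow> ('s, 'a) policy \<Rightarrow>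
      nat \<Rightarrow> (nat \<Rightarrow> 's \<times> 'a) \<Rightarrow> ('s \<times> 'a) measure" where
  "step_law A \<mu> Q \<pi> 0 \<omega> = \<mu> \<bind> with_action A \<pi>"
| "step_law A \<mu> Q \<pi> (Suc n) \<omega> = Q (\<omega> n) \<bind> with_action A \<pi>"

text \<open>
  Law of the whole trajectory with initial state law \<open>\<mu>\<close>, as the projective limit given by the
  Ionescu-Tulcea theorem.
\<close>

definition trajectory ::
    "'a measure \<Rightarrow> 's measure \<Rightarrow> ('s::topological_space, 'a) kernel \<Rightarrow> ('s, 'a) policy \<Rightarrow>
      (nat \<Rightarrow> 's \<times> 'a) measure" where
  "trajectory A \<mu> Q \<pi> =
    projective_family.lim UNIV
      (Ionescu_Tulcea.CI (step_law A \<mu> Q \<pi>) (\<lambda>_. state_action A)) (\<lambda>_. state_action A)"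

lemma measurable_with_action[measurable]:
  assumes [measurable]: "\<pi> \<in> policies A"
  shows "with_action A \<pi> \<in> borel \<rightarrow>\<^sub>M prob_algebra (state_action A)"
  unfolding with_action_def[abs_def]
  by (rule measurable_distr_prob_space2[where M = A]) measurable

lemma Ionescu_Tulcea_step_law:
  assumes \<mu>: "\<mu> \<in> space (prob_algebra borel)" and [measurable]: "Q \<in> kernels A" "\<pi> \<in> policies A"
  shows "Ionescu_Tulcea (step_law A \<mu> Q \<pi>) (\<lambda>_. state_action A)"
proof -
  have step: "step_law A \<mu> Q \<pi> n
      \<in> PiM {0..<n} (\<lambda>_. state_action A) \<rightarrow>\<^sub>M prob_algebra (state_action A)" for n
  proof (cases n)
    case 0
    have [measurable]: "(\<lambda>_. \<mu>) \<in> PiM {0..<0} (\<lambda>_. state_action A) \<rightarrow>\<^sub>M prob_algebra borel"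
      using \<mu> by simp
    show ?thesis unfolding 0 step_law.simps by measurable
  next
    case (Suc m)
    show ?thesis unfolding Suc step_law.simps by measurable
  qed
  have "prob_space (step_law A \<mu> Q \<pi> n \<omega>)"
    if "\<omega> \<in> space (PiM {0..<n} (\<lambda>_. state_action A))" for n \<omega>
    using measurable_space[OF step that] by (simp add: space_prob_algebra)
  then show ?thesis
    unfolding Ionescu_Tulcea_def using measurable_prob_algebraD[OF step] by blast
qed

definition state_value ::
    "real \<Rightarrow> 'a measure \<Rightarrow> ('s \<times> 'a \<Rightarrow> real) \<Rightarrow> ('s::topological_space, 'a) kernel \<Rightarrow>
      ('s, 'a) policy \<Rightarrow> 's \<Rightarrow> real" where
  "state_value \<gamma> A r Q \<pi> s =
    (\<integral>\<omega>. (\<Sum>t. \<gamma> ^ t * r (\<omega> t)) \<partial>trajectory A (return borel s) Q \<pi>)"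

definition policy_value ::
    "real \<Rightarrow> 'a measure \<Rightarrow> 's measure \<Rightarrow> ('s \<times> 'a \<Rightarrow> real) \<Rightarrow>
      ('s::topological_space, 'a) kernel \<Rightarrow> ('s, 'a) policy \<Rightarrow> real" where
  "policy_value \<gamma> A \<rho>\<^sub>0 r Q \<pi> = (\<integral>s. state_value \<gamma> A r Q \<pi> s \<partial>\<rho>\<^sub>0)"

text \<open>
  Unnormalized discounted occupancy as a measure: \<open>B\<close> is mapped to the expected discounted number
  of visits to \<open>B\<close>.
\<close>

definition occupancy ::
    "real \<Rightarrow> 'a measure \<Rightarrow> 's measure \<Rightarrow> ('s::topological_space, 'a) kernel \<Rightarrow>
      ('s, 'a) policy \<Rightarrow> ('s \<times> 'a) measure" where
  "occupancy \<gamma> A \<rho>\<^sub>0 P \<pi> =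
    measure_of (space (state_action A)) (sets (state_action A))
      (\<lambda>B. \<integral>\<^sup>+\<omega>. (\<Sum>t. ennreal (\<gamma> ^ t) * indicator B (\<omega> t)) \<partial>trajectory A \<rho>\<^sub>0 P \<pi>)"

lemma emeasure_occupancy:
  assumes "\<rho>\<^sub>0 \<in> space (prob_algebra borel)" "P \<in> kernels A" "\<pi> \<in> policies A"
    and B: "B \<in> sets (state_action A)"
  shows "emeasure (occupancy \<gamma> A \<rho>\<^sub>0 P \<pi>) B =
    (\<integral>\<^sup>+\<omega>. (\<Sum>t. ennreal (\<gamma> ^ t) * indicator B (\<omega> t)) \<partial>trajectory A \<rho>\<^sub>0 P \<pi>)"
proof -
  interpret Ionescu_Tulcea "step_law A \<rho>\<^sub>0 P \<pi>" "\<lambda>_. state_action A"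
    using assms by (intro Ionescu_Tulcea_step_law)
  let ?T = "trajectory A \<rho>\<^sub>0 P \<pi>"
  let ?f = "\<lambda>B \<omega>. \<Sum>t. ennreal (\<gamma> ^ t) * indicator B (\<omega> t)"
  have sets_T[measurable_cong]: "sets ?T = sets (PiM UNIV (\<lambda>_. state_action A))"
    unfolding trajectory_def by (rule PF.sets_lim)
  have meas[measurable]: "(\<lambda>\<omega>. ennreal (\<gamma> ^ t) * indicator C (\<omega> t)) \<in> borel_measurable ?T"
    if [measurable]: "C \<in> sets (state_action A)" for C t
    by measurable
  show ?thesis
  proof (rule emeasure_measure_of[OF occupancy_def])
    show "sets (state_action A) \<subseteq> Pow (space (state_action A))"
      by (rule sets.space_closed)
    show "positive (sets (occupancy \<gamma> A \<rho>\<^sub>0 P \<pi>)) (\<lambda>B. \<integral>\<^sup>+\<omega>. ?f B \<omega> \<partial>?T)"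
      by (simp add: positive_def)
    show "countably_additive (sets (occupancy \<gamma> A \<rho>\<^sub>0 P \<pi>)) (\<lambda>B. \<integral>\<^sup>+\<omega>. ?f B \<omega> \<partial>?T)"
    proof (rule countably_additiveI)
      fix C :: "nat \<Rightarrow> ('a \<times> 'b) set"
      assume "range C \<subseteq> sets (occupancy \<gamma> A \<rho>\<^sub>0 P \<pi>)" and disj: "disjoint_family C"
      then have C[measurable]: "C i \<in> sets (state_action A)" for i
        by (auto simp: occupancy_def sets.sigma_sets_eq)
      have "(\<Sum>i. \<integral>\<^sup>+\<omega>. ?f (C i) \<omega> \<partial>?T) = (\<integral>\<^sup>+\<omega>. (\<Sum>i. ?f (C i) \<omega>) \<partial>?T)"
        by (rule nn_integral_suminf[symmetric]) measurable
      also have "(\<lambda>\<omega>. \<Sum>i. ?f (C i) \<omega>) = ?f (\<Union>i. C i)"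
      proof
        fix \<omega> :: "nat \<Rightarrow> 'a \<times> 'b"
        have "(\<Sum>i. ?f (C i) \<omega>) = (\<Sum>t. \<Sum>i. ennreal (\<gamma> ^ t) * indicator (C i) (\<omega> t))"
          by (subst (1 3) nn_integral_count_space_nat[symmetric], subst nn_integral_suminf) simp_all
        also have "\<dots> = ?f (\<Union>i. C i) \<omega>"
          by (simp add: suminf_indicator[OF disj])
        finally show "(\<Sum>i. ?f (C i) \<omega>) = ?f (\<Union>i. C i) \<omega>" .
      qed
      finally show "(\<Sum>i. \<integral>\<^sup>+\<omega>. ?f (C i) \<omega> \<partial>?T) = (\<integral>\<^sup>+\<omega>. ?f (\<Union>i. C i) \<omega> \<partial>?T)" .
    qed
    show "B \<in> sets (occupancy \<gamma> A \<rho>\<^sub>0 P \<pi>)"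
      using B by (simp add: occupancy_def sets.sigma_sets_eq)
  qed
qed

definition couplings :: "'s::metric_space measure \<Rightarrow> 's measure \<Rightarrow> ('s \<times> 's) measure set" where
  "couplings \<mu> \<nu> =
    {\<kappa>. sets \<kappa> = sets (borel \<Otimes>\<^sub>M borel) \<and> distr \<kappa> borel fst = \<mu> \<and> distr \<kappa> borel snd = \<nu>}"

text \<open>
  Extended-valued, since no finite first moments are assumed. If the space is not separable, \<open>dist\<close>
  need not be measurable for the product sigma-algebra, and the inner integral is a lower integral.
\<close>

definition wasserstein1 :: "'s::metric_space measure \<Rightarrow> 's measure \<Rightarrow> ennreal" where
  "wasserstein1 \<mu> \<nu> = (INF \<kappa>\<in>couplings \<mu> \<nu>. \<integral>\<^sup>+(x, y). ennreal (dist x y) \<partial>\<kappa>)"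

definition error_reward ::
    "('s::metric_space, 'a) kernel \<Rightarrow> ('s, 'a) kernel \<Rightarrow> 's \<times> 'a \<Rightarrow> ennreal" where
  "error_reward P P' sa = wasserstein1 (P sa) (P' sa)"

text \<open>
  For a reward that is not measurable, the integral below is the lower integral, i.e. the least
  possible reading of the value.
\<close>

definition error_value ::
    "real \<Rightarrow> 'a measure \<Rightarrow> 's measure \<Rightarrow> ('s::metric_space, 'a) kernel \<Rightarrow> ('s, 'a) kernel \<Rightarrow>
      ('s, 'a) policy \<Rightarrow> ennreal" where
  "error_value \<gamma> A \<rho>\<^sub>0 P P' \<pi> = (\<integral>\<^sup>+sa. error_reward P P' sa \<partial>occupancy \<gamma> A \<rho>\<^sub>0 P \<pi>)"

definition optimal_error_value ::
    "real \<Rightarrow> 'a measure \<Rightarrow> 's measure \<Rightarrow> ('s::metric_space, 'a) kernel \<Rightarrow> ('s, 'a) kernel \<Rightarrow>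
      ('s, 'a) policy set \<Rightarrow> ennreal" where
  "optimal_error_value \<gamma> A \<rho>\<^sub>0 P P' Pols = (SUP \<pi>\<in>Pols. error_value \<gamma> A \<rho>\<^sub>0 P P' \<pi>)"

end

theory Submission
  imports Defs
begin

text \<open>
  Let \<open>V\<close> be the value function of \<open>\<pi>\<close> under the simulator. By its Bellman equation, the expected
  reward at time \<open>t\<close> under the true kernel is the expected \<open>V\<close> at time \<open>t\<close> minus \<open>\<gamma>\<close> times the expected
  \<open>V\<close> after a simulated step. Adding and subtracting a true step, the discounted sum telescopes, so
  that the two policy values differ by \<open>\<gamma>\<close> times the occupancy integral of
  \<open>(\<integral>s. V s \<partial>P x) - (\<integral>s. V s \<partial>Phat x)\<close>. Since \<open>V\<close> is Lipschitz, every coupling bounds this integrand by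
  \<open>L\<^sub>v\<close> times the transport cost.
\<close>

section \<open>Bounded functions integrated against compositions of probability kernels\<close>

lemma integrable_prob_algebra:
  fixes f :: "'b \<Rightarrow> real"
  assumes "M \<in> space (prob_algebra K)" "f \<in> borel_measurable K"
    and "\<And>x. x \<in> space K \<Longrightarrow> \<bar>f x\<bar> \<le> B"
  shows "integrable M f"
proof -
  interpret prob_space M using assms(1) by (simp add: space_prob_algebra)
  have "sets M = sets K" using assms(1) by (simp add: space_prob_algebra)
  then have "f \<in> borel_measurable M" "space M = space K"
    using assms(2) sets_eq_imp_space_eq[of M K] by (simp_all cong: measurable_cong_sets)
  then show ?thesis
    using assms(3) by (intro integrable_const_bound[where B = B]) auto
qed

lemma abs_integral_le_prob_algebra:
  fixes f :: "'b \<Rightarrow> real"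
  assumes "M \<in> space (prob_algebra K)" "f \<in> borel_measurable K"
    and "\<And>x. x \<in> space K \<Longrightarrow> \<bar>f x\<bar> \<le> B"
  shows "\<bar>\<integral>x. f x \<partial>M\<bar> \<le> B"
proof -
  interpret prob_space M using assms(1) by (simp add: space_prob_algebra)
  have M: "space M = space K"
    using assms(1) sets_eq_imp_space_eq[of M K] by (simp add: space_prob_algebra)
  have "\<bar>\<integral>x. f x \<partial>M\<bar> \<le> (\<integral>x. \<bar>f x\<bar> \<partial>M)"
    by (rule integral_abs_bound)
  also have "\<dots> \<le> (\<integral>x. B \<partial>M)"
    using integrable_prob_algebra[OF assms] assms(3) M by (intro integral_mono) auto
  finally show ?thesis by (simp add: prob_space)
qed

lemma integral_bind_prob_algebra:
  fixes f :: "'b \<Rightarrow> real"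
  assumes M: "M \<in> space (prob_algebra L)" and N: "N \<in> L \<rightarrow>\<^sub>M prob_algebra K"
    and f: "f \<in> borel_measurable K" "\<And>x. x \<in> space K \<Longrightarrow> \<bar>f x\<bar> \<le> B"
  shows "(\<integral>x. f x \<partial>(M \<bind> N)) = (\<integral>x. \<integral>y. f y \<partial>N x \<partial>M)"
proof (rule integral_bind[OF f])
  have sets_M: "sets M = sets L" and "prob_space M"
    using M by (simp_all add: space_prob_algebra)
  then show "finite_measure M" by (simp add: prob_space_def)
  show "N \<in> M \<rightarrow>\<^sub>M subprob_algebra K"
    using measurable_prob_algebraD[OF N] sets_M by (simp cong: measurable_cong_sets)
  have "prob_space (N x)" if "x \<in> space M" for x
    using measurable_space[OF N] that sets_eq_imp_space_eq[OF sets_M]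
    by (simp add: space_prob_algebra)
  then show "AE x in M. emeasure (N x) (space (N x)) \<le> ennreal 1"
    by (intro AE_I2) (simp add: prob_space.emeasure_space_1)
qed

lemma bind_in_prob_algebra:
  assumes "M \<in> space (prob_algebra L)" "N \<in> L \<rightarrow>\<^sub>M prob_algebra K"
  shows "M \<bind> N \<in> space (prob_algebra K)"
  using prob_space_bind'[OF assms] sets_bind'[OF assms] by (simp add: space_prob_algebra)

lemma bind_assoc_prob_algebra:
  assumes M: "M \<in> space (prob_algebra L)"
    and f: "f \<in> L \<rightarrow>\<^sub>M prob_algebra N" and g: "g \<in> N \<rightarrow>\<^sub>M prob_algebra R"
  shows "(M \<bind> f) \<bind> g = M \<bind> (\<lambda>x. f x \<bind> g)"
  using M measurable_prob_algebraD[OF f]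
  by (intro bind_assoc[OF _ measurable_prob_algebraD[OF g]])
     (simp add: space_prob_algebra cong: measurable_cong_sets)

lemma integral_measurable_prob_algebra:
  fixes f :: "'b \<Rightarrow> real"
  assumes "N \<in> L \<rightarrow>\<^sub>M prob_algebra K" "f \<in> borel_measurable K"
  shows "(\<lambda>x. \<integral>y. f y \<partial>N x) \<in> borel_measurable L"
  using measurable_compose[OF measurable_prob_algebraD integral_measurable_subprob_algebra] assms
  by blast

section \<open>One-coordinate marginals of an Ionescu-Tulcea process\<close>

text \<open>The last stage \<open>eP n\<close> appends to a history a coordinate \<open>n\<close>
  drawn from \<open>P n\<close>, and projecting to that coordinate forgets the history
  again.\<close>

lemma (in Ionescu_Tulcea) distr_C_component:
  "distr (C 0 (Suc n) (\<lambda>_. undefined)) (M n) (\<lambda>\<omega>. \<omega> n) = C 0 n (\<lambda>_. undefined) \<bind> P n"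
proof -
  let ?C = "C 0 n (\<lambda>_. undefined)"
  have [simp]: "(\<lambda>_. undefined) \<in> space (PiM {0..<0} M)" by simp
  have sets_C0: "sets ?C = sets (PiM {0..<n} M)" and space_C0: "space ?C = space (PiM {0..<n} M)"
    using sets_C[of "\<lambda>_. undefined" 0 n] space_C[of "\<lambda>_. undefined" 0 n] by simp_all
  \<comment> \<open>On an empty space \<open>bind\<close> takes a default value, so pushing
    \<open>distr\<close> through it requires a nonempty space.\<close>
  have ne: "space ?C \<noteq> {}"
    using prob_space.not_empty[OF prob_space_C[of "\<lambda>_. undefined" 0 n]] by simp
  have "distr (?C \<bind> eP n) (M n) (\<lambda>\<omega>. \<omega> n) = ?C \<bind> (\<lambda>\<omega>. distr (eP n \<omega>) (M n) (\<lambda>\<omega>. \<omega> n))"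
    by (rule distr_bind[where K = "PiM {0..<Suc n} M"])
       (use ne sets_C0 in \<open>auto cong: measurable_cong_sets intro: measurable_component_singleton\<close>)
  also have "\<dots> = ?C \<bind> P n"
  proof (rule bind_cong[OF refl])
    fix \<omega> assume "\<omega> \<in> space ?C"
    then have \<omega>: "\<omega> \<in> space (PiM {0..<n} M)" by (simp add: space_C0)
    \<comment> \<open>\<open>eP n \<omega>\<close> is the image of \<open>P n \<omega>\<close> under
      \<open>fun_upd \<omega> n\<close>, and reading coordinate \<open>n\<close> after this update
      is the identity.\<close>
    have "distr (eP n \<omega>) (M n) (\<lambda>\<omega>. \<omega> n) = distr (P n \<omega>) (M n) ((\<lambda>\<omega>. \<omega> n) \<circ> fun_upd \<omega> n)"
      unfolding eP_def using \<omega>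
      by (intro distr_distr measurable_fun_upd[where J = "{0..<n}"])
         (auto simp: sets_P intro: measurable_component_singleton)
    also have "\<dots> = P n \<omega>"
      using \<omega> by (simp add: comp_def distr_id2 sets_P)
    finally show "distr (eP n \<omega>) (M n) (\<lambda>\<omega>. \<omega> n) = P n \<omega>" .
  qed
  finally show ?thesis by simp
qed

text \<open>Coordinate \<open>n\<close> depends only on the marginal of the limit on the index set
  \<open>{n}\<close>, and this marginal comes from a finite stage of the construction.\<close>

lemma (in Ionescu_Tulcea) distr_lim_component:
  "distr PF.lim (M n) (\<lambda>\<omega>. \<omega> n) = C 0 n (\<lambda>_. undefined) \<bind> P n"
proof -
  \<comment> \<open>\<open>CI {n}\<close> is cut out of the stage \<open>up_to {n}\<close>, whose
    coordinates are \<open>{0..<Suc n}\<close>; coordinate \<open>n\<close> is thus the last one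
    added.\<close>
  have up: "up_to {n} = Suc n"
    using up_to_less[of "{n}" n] up_to_iff[of "{n}" "Suc n"] by auto
  have "distr PF.lim (M n) (\<lambda>\<omega>. \<omega> n) =
      distr (distr PF.lim (PiM {n} M) (\<lambda>\<omega>. restrict \<omega> {n})) (M n) (\<lambda>\<omega>. \<omega> n)"
    by (subst distr_distr)
       (auto simp: comp_def measurable_cong_sets[OF PF.sets_lim refl]
         intro!: measurable_restrict measurable_component_singleton)
  also have "\<dots> = distr (CI {n}) (M n) (\<lambda>\<omega>. \<omega> n)"
    by (simp add: distr_lim)
  also have "\<dots> = distr (C 0 (Suc n) (\<lambda>_. undefined)) (M n) (\<lambda>\<omega>. \<omega> n)"
  proof -
    have sets_C0: "sets (C 0 (Suc n) (\<lambda>_. undefined)) = sets (PiM {0..<Suc n} M)"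
      using sets_C[of "\<lambda>_. undefined" 0 "Suc n"] by simp
    show ?thesis
      unfolding CI_def up
      by (subst distr_distr)
         (auto simp: comp_def measurable_cong_sets[OF sets_C0 refl] simp del: C.simps
           intro!: measurable_restrict measurable_component_singleton)
  qed
  finally show ?thesis by (simp only: distr_C_component)
qed

section \<open>Laws of the controlled chain at a fixed time\<close>

text \<open>Law of \<open>(s\<^sub>t, a\<^sub>t)\<close> when the chain starts in the state \<open>s\<close>.\<close>

primrec pair_law ::
    "'a measure \<Rightarrow> ('s::topological_space, 'a) kernel \<Rightarrow> ('s, 'a) policy \<Rightarrow>
      nat \<Rightarrow> 's \<Rightarrow> ('s \<times> 'a) measure" where
  "pair_law A Q \<pi> 0 s = with_action A \<pi> s"
| "pair_law A Q \<pi> (Suc t) s = pair_law A Q \<pi> t s \<bind> (\<lambda>x. Q x \<bind> with_action A \<pi>)"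

lemma measurable_pair_law[measurable]:
  assumes [measurable]: "Q \<in> kernels A" "\<pi> \<in> policies A"
  shows "pair_law A Q \<pi> t \<in> borel \<rightarrow>\<^sub>M prob_algebra (state_action A)"
proof (induction t)
  case 0
  have "pair_law A Q \<pi> 0 = with_action A \<pi>" by auto
  then show ?case by simp
next
  case (Suc t)
  note Suc[measurable]
  have "pair_law A Q \<pi> (Suc t) = (\<lambda>s. pair_law A Q \<pi> t s \<bind> (\<lambda>x. Q x \<bind> with_action A \<pi>))" by auto
  then show ?case by simp
qed

text \<open>The recursion for \<open>pair_law\<close> adds a step at the end of the path, whereas
  the Bellman equation splits off the first step. Associativity of \<open>bind\<close> turns one
  form into the other.\<close>

lemma pair_law_Suc_shift:
  assumes Q[measurable]: "Q \<in> kernels A" and \<pi>[measurable]: "\<pi> \<in> policies A"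
  shows "pair_law A Q \<pi> (Suc t) s = (with_action A \<pi> s \<bind> Q) \<bind> pair_law A Q \<pi> t"
proof (induction t)
  have wa: "with_action A \<pi> s \<in> space (prob_algebra (state_action A))"
    by (rule measurable_space[OF measurable_with_action[OF \<pi>]]) simp
  have waQ: "with_action A \<pi> s \<bind> Q \<in> space (prob_algebra borel)"
    by (rule bind_in_prob_algebra[OF wa Q])
  case 0
  have "pair_law A Q \<pi> 0 = with_action A \<pi>" by auto
  then show ?case
    by (simp add: bind_assoc_prob_algebra[OF wa Q measurable_with_action[OF \<pi>]])
  case (Suc t)
  have step: "(\<lambda>x. Q x \<bind> with_action A \<pi>)
      \<in> state_action A \<rightarrow>\<^sub>M prob_algebra (state_action A)" by measurable
  have "pair_law A Q \<pi> (Suc t) = (\<lambda>s. pair_law A Q \<pi> t s \<bind> (\<lambda>x. Q x \<bind> with_action A \<pi>))"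
    by auto
  then show ?case
    by (subst pair_law.simps(2), subst Suc)
       (simp only: bind_assoc_prob_algebra[OF waQ measurable_pair_law[OF Q \<pi>] step])
qed

text \<open>Bridge from the path measure to iterated kernels: expected discounted sums can then be
  computed from laws at single times.\<close>

lemma distr_trajectory:
  assumes \<mu>: "\<mu> \<in> space (prob_algebra borel)"
    and Q[measurable]: "Q \<in> kernels A" and \<pi>[measurable]: "\<pi> \<in> policies A"
  shows "distr (trajectory A \<mu> Q \<pi>) (state_action A) (\<lambda>\<omega>. \<omega> t) = \<mu> \<bind> pair_law A Q \<pi> t"
proof -
  interpret Ionescu_Tulcea "step_law A \<mu> Q \<pi>" "\<lambda>_. state_action A"
    using assms by (intro Ionescu_Tulcea_step_law)
  let ?K = "\<lambda>x. Q x \<bind> with_action A \<pi>"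
  have step: "?K \<in> state_action A \<rightarrow>\<^sub>M prob_algebra (state_action A)" by measurable
  have "C 0 t (\<lambda>_. undefined) \<bind> step_law A \<mu> Q \<pi> t = \<mu> \<bind> pair_law A Q \<pi> t"
  proof (induction t)
    case 0
    have "step_law A \<mu> Q \<pi> 0 = (\<lambda>_. \<mu> \<bind> with_action A \<pi>)"
      "pair_law A Q \<pi> 0 = with_action A \<pi>" by auto
    \<comment> \<open>Stage 0 is the point mass at the empty history, represented by the constantly
      \<open>undefined\<close> function.\<close>
    moreover have "return (PiM {0..<0} (\<lambda>_. state_action A)) (\<lambda>_. undefined) \<bind> step_law A \<mu> Q \<pi> 0
        = step_law A \<mu> Q \<pi> 0 (\<lambda>_. undefined)"
      by (rule bind_return[OF P]) simp
    ultimately show ?case by simp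
  next
    case (Suc t)
    let ?C = "C 0 (Suc t) (\<lambda>_. undefined)"
    have ne: "space ?C \<noteq> {}"
      by (rule prob_space.not_empty[OF prob_space_C]) simp
    have "sets ?C = sets (PiM {0..<Suc t} (\<lambda>_. state_action A))"
      using sets_C[of "\<lambda>_. undefined" 0 "Suc t"] by simp
    then have comp: "(\<lambda>\<omega>. \<omega> t) \<in> ?C \<rightarrow>\<^sub>M state_action A"
      by (subst measurable_cong_sets[OF _ refl]) (auto intro!: measurable_component_singleton)
    \<comment> \<open>Markov property: the conditional law reads only the last entry of the history,
      so the history may be replaced by the law of that entry.\<close>
    have "step_law A \<mu> Q \<pi> (Suc t) = (\<lambda>\<omega>. ?K (\<omega> t))" by auto
    then have "?C \<bind> step_law A \<mu> Q \<pi> (Suc t) = ?C \<bind> (\<lambda>\<omega>. ?K (\<omega> t))" by simp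
    also have "\<dots> = distr ?C (state_action A) (\<lambda>\<omega>. \<omega> t) \<bind> ?K"
      by (rule bind_distr[OF comp measurable_prob_algebraD[OF step] ne, symmetric])
    also have "\<dots> = (\<mu> \<bind> pair_law A Q \<pi> t) \<bind> ?K"
      by (simp only: distr_C_component Suc)
    also have "\<dots> = \<mu> \<bind> pair_law A Q \<pi> (Suc t)"
    proof -
      have "pair_law A Q \<pi> (Suc t) = (\<lambda>s. pair_law A Q \<pi> t s \<bind> ?K)" by auto
      then show ?thesis
        by (simp only: bind_assoc_prob_algebra[OF \<mu> measurable_pair_law[OF Q \<pi>] step])
    qed
    finally show ?case .
  qed
  then show ?thesis
    unfolding trajectory_def by (simp only: distr_lim_component)
qed


section \<open>Value functions of a bounded reward and the Bellman equation\<close>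

text \<open>The kernel is not part of the fixed data, because one policy and one reward are
  evaluated under two kernels.\<close>

locale bounded_policy_reward =
  fixes \<gamma> B :: real and A :: "'a measure" and r :: "'s::topological_space \<times> 'a \<Rightarrow> real"
    and \<pi> :: "('s, 'a) policy"
  assumes discount: "0 < \<gamma>" "\<gamma> < 1"
    and reward[measurable]: "r \<in> borel_measurable (state_action A)"
    and abs_reward_le: "\<And>x. x \<in> space (state_action A) \<Longrightarrow> \<bar>r x\<bar> \<le> B"
    and policy[measurable]: "\<pi> \<in> policies A"
begin

lemma with_action_in_prob_algebra: "with_action A \<pi> s \<in> space (prob_algebra (state_action A))"
  by (rule measurable_space[OF measurable_with_action[OF policy]]) simp

lemma summable_discount: "summable (\<lambda>t. \<gamma> ^ t * b)"
  using discount by (intro summable_mult2 summable_geometric) simp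

lemma abs_expected_reward_le:
  "M \<in> space (prob_algebra (state_action A)) \<Longrightarrow> \<bar>\<integral>x. r x \<partial>M\<bar> \<le> B"
  by (rule abs_integral_le_prob_algebra[OF _ reward abs_reward_le])

context
  fixes Q :: "('s, 'a) kernel"
  assumes Q[measurable]: "Q \<in> kernels A"
begin

lemma bind_pair_law_in_prob_algebra:
  "\<mu> \<in> space (prob_algebra borel) \<Longrightarrow>
    \<mu> \<bind> pair_law A Q \<pi> t \<in> space (prob_algebra (state_action A))"
  by (rule bind_in_prob_algebra[OF _ measurable_pair_law[OF Q policy]])

lemma pair_law_in_prob_algebra: "pair_law A Q \<pi> t s \<in> space (prob_algebra (state_action A))"
  by (rule measurable_space[OF measurable_pair_law[OF Q policy]]) simp

text \<open>The terms are dominated by the summable \<open>\<gamma> ^ t * B\<close>, so series and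
  integral may be exchanged; each term then involves a single coordinate of the path.\<close>

lemma sums_trajectory:
  assumes \<mu>: "\<mu> \<in> space (prob_algebra borel)"
  shows "(\<lambda>t. \<gamma> ^ t * (\<integral>x. r x \<partial>(\<mu> \<bind> pair_law A Q \<pi> t))) sums
    (\<integral>\<omega>. (\<Sum>t. \<gamma> ^ t * r (\<omega> t)) \<partial>trajectory A \<mu> Q \<pi>)"
proof -
  interpret IT: Ionescu_Tulcea "step_law A \<mu> Q \<pi>" "\<lambda>_. state_action A"
    using \<mu> Q policy by (intro Ionescu_Tulcea_step_law)
  let ?T = "trajectory A \<mu> Q \<pi>"
  have sets_T: "sets ?T = sets (PiM UNIV (\<lambda>_. state_action A))"
    unfolding trajectory_def by (rule IT.PF.sets_lim)
  have comp[measurable]: "(\<lambda>\<omega>. \<omega> t) \<in> ?T \<rightarrow>\<^sub>M state_action A" for t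
    by (subst measurable_cong_sets[OF sets_T refl]) (auto intro!: measurable_component_singleton)
  \<comment> \<open>The path measure has total mass one because its image under the coordinate at
    time 0 does.\<close>
  have "prob_space (distr ?T (state_action A) (\<lambda>\<omega>. \<omega> 0))"
    using bind_pair_law_in_prob_algebra[OF \<mu>, of 0]
    by (simp only: distr_trajectory[OF \<mu> Q policy] space_prob_algebra) simp
  then interpret prob_space ?T
    by (rule prob_space_distrD[OF comp])
  have bound: "\<bar>r (\<omega> t)\<bar> \<le> B" if "\<omega> \<in> space ?T" for \<omega> t
    using measurable_space[OF comp that] by (rule abs_reward_le)
  have norm_bound: "norm (\<gamma> ^ t * r (\<omega> t)) \<le> \<gamma> ^ t * B" if "\<omega> \<in> space ?T" for \<omega> t
    using bound[OF that, of t] discount by (simp add: abs_mult)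
  have int: "integrable ?T (\<lambda>\<omega>. \<gamma> ^ t * r (\<omega> t))" for t
    using norm_bound by (intro integrable_const_bound[where B = "\<gamma> ^ t * B"]) (auto intro: AE_I2)
  have "(\<lambda>t. \<integral>\<omega>. \<gamma> ^ t * r (\<omega> t) \<partial>?T) sums (\<integral>\<omega>. (\<Sum>t. \<gamma> ^ t * r (\<omega> t)) \<partial>?T)"
  proof (rule sums_integral[OF int])
    show "AE \<omega> in ?T. summable (\<lambda>t. norm (\<gamma> ^ t * r (\<omega> t)))"
      using norm_bound
      by (intro AE_I2 summable_comparison_test'[OF summable_discount[of B], of 0]) auto
    have "(\<integral>\<omega>. norm (\<gamma> ^ t * r (\<omega> t)) \<partial>?T) \<le> (\<integral>\<omega>. \<gamma> ^ t * B \<partial>?T)" for t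
      using norm_bound int by (intro integral_mono) auto
    then show "summable (\<lambda>t. \<integral>\<omega>. norm (\<gamma> ^ t * r (\<omega> t)) \<partial>?T)"
      by (intro summable_comparison_test'[OF summable_discount[of B], of 0]) (auto simp: prob_space)
  qed
  moreover have "(\<integral>\<omega>. \<gamma> ^ t * r (\<omega> t) \<partial>?T) = \<gamma> ^ t * (\<integral>x. r x \<partial>(\<mu> \<bind> pair_law A Q \<pi> t))" for t
  proof -
    have "(\<integral>\<omega>. r (\<omega> t) \<partial>?T) = (\<integral>x. r x \<partial>distr ?T (state_action A) (\<lambda>\<omega>. \<omega> t))"
      by (rule integral_distr[OF comp reward, symmetric])
    then show ?thesis by (simp add: distr_trajectory[OF \<mu> Q policy])
  qed
  ultimately show ?thesis by (simp only:)
qed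

lemma state_value_sums:
  "(\<lambda>t. \<gamma> ^ t * (\<integral>x. r x \<partial>pair_law A Q \<pi> t s)) sums state_value \<gamma> A r Q \<pi> s"
proof -
  have "return borel s \<bind> pair_law A Q \<pi> t = pair_law A Q \<pi> t s" for t
    by (rule bind_return[OF measurable_prob_algebraD[OF measurable_pair_law[OF Q policy]]]) simp
  moreover have "return borel s \<in> space (prob_algebra borel)"
    by (simp add: space_prob_algebra prob_space_return)
  ultimately show ?thesis
    using sums_trajectory[of "return borel s"] by (simp add: state_value_def)
qed

text \<open>In the definition the starting state enters through the path measure. The series form
  exhibits the value as a countable sum of kernel integrals, each measurable in
  \<open>s\<close>.\<close>

lemma measurable_state_value[measurable]: "state_value \<gamma> A r Q \<pi> \<in> borel_measurable borel"
proof -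
  have "state_value \<gamma> A r Q \<pi> = (\<lambda>s. \<Sum>t. \<gamma> ^ t * (\<integral>x. r x \<partial>pair_law A Q \<pi> t s))"
    using sums_unique[OF state_value_sums] by auto
  moreover have [measurable]: "(\<lambda>s. \<integral>x. r x \<partial>pair_law A Q \<pi> t s) \<in> borel_measurable borel" for t
    by (rule integral_measurable_prob_algebra[OF measurable_pair_law[OF Q policy] reward])
  ultimately show ?thesis by simp
qed

lemma abs_state_value_le: "\<bar>state_value \<gamma> A r Q \<pi> s\<bar> \<le> B / (1 - \<gamma>)"
proof -
  have le: "norm (\<gamma> ^ t * (\<integral>x. r x \<partial>pair_law A Q \<pi> t s)) \<le> \<gamma> ^ t * B" for t
    using abs_expected_reward_le[OF pair_law_in_prob_algebra] discount
    by (simp add: abs_mult)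
  have "norm (\<Sum>t. \<gamma> ^ t * (\<integral>x. r x \<partial>pair_law A Q \<pi> t s)) \<le> (\<Sum>t. \<gamma> ^ t * B)"
    by (rule norm_suminf_le[OF le summable_discount])
  also have "\<dots> = B / (1 - \<gamma>)"
    using discount by (simp add: suminf_mult2[symmetric] suminf_geometric)
  finally show ?thesis
    using sums_unique[OF state_value_sums, of s] by simp
qed

text \<open>\<open>policy_value\<close> averages the values of fixed starting states. Exchanging
  this average with the series, again by domination, gives the laws of the chain started from
  \<mu>.\<close>

lemma policy_value_sums:
  assumes \<mu>: "\<mu> \<in> space (prob_algebra borel)"
  shows "(\<lambda>t. \<gamma> ^ t * (\<integral>x. r x \<partial>(\<mu> \<bind> pair_law A Q \<pi> t))) sums policy_value \<gamma> A \<mu> r Q \<pi>"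
proof -
  interpret prob_space \<mu> using \<mu> by (simp add: space_prob_algebra)
  let ?f = "\<lambda>t s. \<integral>x. r x \<partial>pair_law A Q \<pi> t s"
  have meas: "?f t \<in> borel_measurable borel" for t
    by (rule integral_measurable_prob_algebra[OF measurable_pair_law[OF Q policy] reward])
  have bound: "\<bar>?f t s\<bar> \<le> B" for t s
    by (rule abs_expected_reward_le[OF pair_law_in_prob_algebra])
  have norm_bound: "norm (\<gamma> ^ t * ?f t s) \<le> \<gamma> ^ t * B" for t s
    using bound[of t s] discount by (simp add: abs_mult)
  have int: "integrable \<mu> (\<lambda>s. \<gamma> ^ t * ?f t s)" for t
    by (intro integrable_mult_right integrable_prob_algebra[OF \<mu> meas bound])
  have "(\<lambda>t. \<integral>s. \<gamma> ^ t * ?f t s \<partial>\<mu>) sums (\<integral>s. (\<Sum>t. \<gamma> ^ t * ?f t s) \<partial>\<mu>)"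
  proof (rule sums_integral[OF int])
    show "AE s in \<mu>. summable (\<lambda>t. norm (\<gamma> ^ t * ?f t s))"
      using norm_bound
      by (intro AE_I2 summable_comparison_test'[OF summable_discount[of B], of 0]) auto
    have "(\<integral>s. norm (\<gamma> ^ t * ?f t s) \<partial>\<mu>) \<le> (\<integral>s. \<gamma> ^ t * B \<partial>\<mu>)" for t
      using norm_bound int by (intro integral_mono) auto
    then show "summable (\<lambda>t. \<integral>s. norm (\<gamma> ^ t * ?f t s) \<partial>\<mu>)"
      by (intro summable_comparison_test'[OF summable_discount[of B], of 0]) (auto simp: prob_space)
  qed
  moreover have "(\<integral>s. ?f t s \<partial>\<mu>) = (\<integral>x. r x \<partial>(\<mu> \<bind> pair_law A Q \<pi> t))" for t
    by (rule integral_bind_prob_algebra[OF \<mu> measurable_pair_law[OF Q policy] reward abs_reward_le,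
          symmetric])
  ultimately show ?thesis
    using sums_unique[OF state_value_sums] by (simp add: policy_value_def)
qed

lemma Bellman_equation:
  "state_value \<gamma> A r Q \<pi> s = (\<integral>x. r x + \<gamma> * (\<integral>s'. state_value \<gamma> A r Q \<pi> s' \<partial>Q x) \<partial>with_action A \<pi> s)"
proof -
  let ?V = "state_value \<gamma> A r Q \<pi>" and ?W = "with_action A \<pi> s"
  note W = with_action_in_prob_algebra[of s]
  have WQ: "?W \<bind> Q \<in> space (prob_algebra borel)"
    by (rule bind_in_prob_algebra[OF W Q])
  \<comment> \<open>\<open>?W \<bind> Q\<close> is the law of the state at time 1. The value from
    there, times \<gamma>, is the series for \<open>s\<close> without its term at time 0, which
    \<open>sums_Suc\<close> puts back.\<close>
  have "(\<lambda>t. \<gamma> * (\<gamma> ^ t * (\<integral>x. r x \<partial>((?W \<bind> Q) \<bind> pair_law A Q \<pi> t))))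
      sums (\<gamma> * (\<integral>s'. ?V s' \<partial>(?W \<bind> Q)))"
    using policy_value_sums[OF WQ] unfolding policy_value_def by (rule sums_mult)
  then have "(\<lambda>t. \<gamma> ^ Suc t * (\<integral>x. r x \<partial>pair_law A Q \<pi> (Suc t) s))
      sums (\<gamma> * (\<integral>s'. ?V s' \<partial>(?W \<bind> Q)))"
    by (simp only: pair_law_Suc_shift[OF Q policy] power_Suc mult.assoc)
  then have "(\<lambda>t. \<gamma> ^ t * (\<integral>x. r x \<partial>pair_law A Q \<pi> t s))
      sums (\<gamma> * (\<integral>s'. ?V s' \<partial>(?W \<bind> Q)) + \<gamma> ^ 0 * (\<integral>x. r x \<partial>pair_law A Q \<pi> 0 s))"
    by (rule sums_Suc)
  then have "?V s = (\<integral>x. r x \<partial>?W) + \<gamma> * (\<integral>s'. ?V s' \<partial>(?W \<bind> Q))"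
    using state_value_sums[of s] sums_unique2 by fastforce
  also have "(\<integral>s'. ?V s' \<partial>(?W \<bind> Q)) = (\<integral>x. \<integral>s'. ?V s' \<partial>Q x \<partial>?W)"
    by (rule integral_bind_prob_algebra[OF W Q measurable_state_value abs_state_value_le])
  also have "(\<integral>x. r x \<partial>?W) + \<gamma> * \<dots> = (\<integral>x. r x + \<gamma> * (\<integral>s'. ?V s' \<partial>Q x) \<partial>?W)"
  proof -
    have "integrable ?W (\<lambda>x. \<integral>s'. ?V s' \<partial>Q x)"
      by (rule integrable_prob_algebra[OF W integral_measurable_prob_algebra[OF Q]
            abs_integral_le_prob_algebra[OF measurable_space[OF Q]]])
         (use measurable_state_value abs_state_value_le in auto)
    then show ?thesis
      using integrable_prob_algebra[OF W reward abs_reward_le] by simp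
  qed
  finally show ?thesis .
qed

end

section \<open>Telescoping the difference of two policy values\<close>

text \<open>All errors are measured along the true chain, but with the simulator's value function.
  The power \<open>Suc t\<close> appears because a kernel error at time \<open>t\<close> first
  affects the state at time \<open>t + 1\<close>.\<close>

lemma policy_value_diff_sums:
  fixes P Q :: "('s, 'a) kernel"
  assumes \<rho>: "\<rho> \<in> space (prob_algebra borel)"
    and P[measurable]: "P \<in> kernels A" and Q[measurable]: "Q \<in> kernels A"
  defines "V \<equiv> state_value \<gamma> A r Q \<pi>"
  shows "(\<lambda>t. \<gamma> ^ Suc t *
      (\<integral>x. (\<integral>s. V s \<partial>P x) - (\<integral>s. V s \<partial>Q x) \<partial>(\<rho> \<bind> pair_law A P \<pi> t)))
    sums (policy_value \<gamma> A \<rho> r P \<pi> - policy_value \<gamma> A \<rho> r Q \<pi>)"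
proof -
  let ?C = "B / (1 - \<gamma>)"
  \<comment> \<open>\<open>\<mu> t\<close> and \<open>\<nu> t\<close> are the laws of \<open>(s\<^sub>t, a\<^sub>t)\<close> and of \<open>s\<^sub>t\<close> under the true kernel.\<close>
  define \<mu> where "\<mu> t = \<rho> \<bind> pair_law A P \<pi> t" for t
  define \<nu> where "\<nu> t = (case t of 0 \<Rightarrow> \<rho> | Suc u \<Rightarrow> \<mu> u \<bind> P)" for t
  have V: "V \<in> borel_measurable borel" "\<And>s. \<bar>V s\<bar> \<le> ?C"
    unfolding V_def by (rule measurable_state_value[OF Q], rule abs_state_value_le[OF Q])
  have \<mu>: "\<mu> t \<in> space (prob_algebra (state_action A))" for t
    unfolding \<mu>_def by (rule bind_pair_law_in_prob_algebra[OF P \<rho>])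
  have \<nu>: "\<nu> t \<in> space (prob_algebra borel)" for t
    unfolding \<nu>_def using \<rho> bind_in_prob_algebra[OF \<mu> P] by (simp split: nat.split)
  have kernel_int: "(\<lambda>x. \<integral>s. V s \<partial>K x) \<in> borel_measurable (state_action A)"
    "\<And>x. x \<in> space (state_action A) \<Longrightarrow> \<bar>\<integral>s. V s \<partial>K x\<bar> \<le> ?C"
    if K: "K \<in> kernels A" for K
    by (rule integral_measurable_prob_algebra[OF K V(1)],
        rule abs_integral_le_prob_algebra[OF measurable_space[OF K] V])
  have integrable_kernel: "integrable (\<mu> t) (\<lambda>x. \<integral>s. V s \<partial>K x)" if "K \<in> kernels A" for K t
    by (rule integrable_prob_algebra[OF \<mu> kernel_int[OF that]])
  \<comment> \<open>Reassociating separates the transition from the choice of action, so that the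
    Bellman equation can be integrated over the state law \<open>\<nu> t\<close>.\<close>
  have \<mu>_eq: "\<mu> t = \<nu> t \<bind> with_action A \<pi>" for t
  proof (cases t)
    case 0
    have "pair_law A P \<pi> 0 = with_action A \<pi>" by auto
    then show ?thesis by (simp add: 0 \<mu>_def \<nu>_def)
  next
    case (Suc u)
    have step: "(\<lambda>x. P x \<bind> with_action A \<pi>)
        \<in> state_action A \<rightarrow>\<^sub>M prob_algebra (state_action A)" by measurable
    have "pair_law A P \<pi> (Suc u) = (\<lambda>s. pair_law A P \<pi> u s \<bind> (\<lambda>x. P x \<bind> with_action A \<pi>))"
      by auto
    then have "\<mu> t = \<mu> u \<bind> (\<lambda>x. P x \<bind> with_action A \<pi>)"
      unfolding Suc \<mu>_def
      by (simp only: bind_assoc_prob_algebra[OF \<rho> measurable_pair_law[OF P policy] step])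
    also have "\<dots> = (\<mu> u \<bind> P) \<bind> with_action A \<pi>"
      by (rule bind_assoc_prob_algebra[OF \<mu> P measurable_with_action[OF policy], symmetric])
    finally show ?thesis by (simp add: Suc \<nu>_def)
  qed
  have V_\<nu>: "(\<integral>s. V s \<partial>\<nu> t) = (\<integral>x. r x \<partial>\<mu> t) + \<gamma> * (\<integral>x. \<integral>s. V s \<partial>Q x \<partial>\<mu> t)" for t
  proof -
    let ?q = "\<lambda>x. r x + \<gamma> * (\<integral>s. V s \<partial>Q x)"
    have q: "?q \<in> borel_measurable (state_action A)"
      using kernel_int(1)[OF Q] by measurable
    have "\<bar>?q x\<bar> \<le> B + \<gamma> * ?C" if "x \<in> space (state_action A)" for x
    proof -
      have "\<bar>?q x\<bar> \<le> \<bar>r x\<bar> + \<gamma> * \<bar>\<integral>s. V s \<partial>Q x\<bar>"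
        using abs_triangle_ineq[of "r x" "\<gamma> * (\<integral>s. V s \<partial>Q x)"] discount by (simp add: abs_mult)
      then show ?thesis
        using abs_reward_le[OF that] mult_left_mono[OF kernel_int(2)[OF Q that], of \<gamma>] discount
        by linarith
    qed
    then have "(\<integral>x. ?q x \<partial>(\<nu> t \<bind> with_action A \<pi>)) = (\<integral>s. \<integral>x. ?q x \<partial>with_action A \<pi> s \<partial>\<nu> t)"
      by (rule integral_bind_prob_algebra[OF \<nu> measurable_with_action[OF policy] q])
    also have "\<dots> = (\<integral>s. V s \<partial>\<nu> t)"
      unfolding V_def by (simp only: Bellman_equation[OF Q, symmetric])
    finally show ?thesis
      using integrable_prob_algebra[OF \<mu> reward abs_reward_le] integrable_kernel[OF Q]
      by (simp add: \<mu>_eq[symmetric])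
  qed
  have V_\<nu>_Suc: "(\<integral>s. V s \<partial>\<nu> (Suc t)) = (\<integral>x. \<integral>s. V s \<partial>P x \<partial>\<mu> t)" for t
    unfolding \<nu>_def by (simp add: integral_bind_prob_algebra[OF \<mu> P V])
  \<comment> \<open>Each error term is the discounted true reward minus a difference of consecutive
    terms of \<open>\<gamma> ^ t * (\<integral>s. V s \<partial>\<nu> t)\<close>.\<close>
  have split: "\<gamma> ^ Suc t * (\<integral>x. (\<integral>s. V s \<partial>P x) - (\<integral>s. V s \<partial>Q x) \<partial>\<mu> t) =
      \<gamma> ^ t * (\<integral>x. r x \<partial>\<mu> t)
      - (\<gamma> ^ t * (\<integral>s. V s \<partial>\<nu> t) - \<gamma> ^ Suc t * (\<integral>s. V s \<partial>\<nu> (Suc t)))" for t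
    by (simp add: V_\<nu>[of t] V_\<nu>_Suc integrable_kernel[OF P] integrable_kernel[OF Q] algebra_simps)
  \<comment> \<open>Since \<open>V\<close> is bounded, the telescoping series leaves only its term
    at time 0. This is the integral of \<open>V\<close> over \<rho>, the policy value under the
    simulator.\<close>
  have "(\<lambda>t. \<gamma> ^ t * (\<integral>s. V s \<partial>\<nu> t)) \<longlonglongrightarrow> 0"
  proof (rule tendsto_rabs_zero_cancel, rule tendsto_sandwich[OF _ _ tendsto_const])
    show "\<forall>\<^sub>F t in sequentially. \<bar>\<gamma> ^ t * (\<integral>s. V s \<partial>\<nu> t)\<bar> \<le> \<gamma> ^ t * ?C"
      using abs_integral_le_prob_algebra[OF \<nu> V] discount
      by (intro always_eventually allI) (simp add: abs_mult mult_left_mono del: times_divide_eq_right)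
    show "(\<lambda>t. \<gamma> ^ t * ?C) \<longlonglongrightarrow> 0"
      using summable_LIMSEQ_zero[OF summable_discount] .
  qed simp
  from telescope_sums'[OF this]
  have "(\<lambda>t. \<gamma> ^ t * (\<integral>s. V s \<partial>\<nu> t) - \<gamma> ^ Suc t * (\<integral>s. V s \<partial>\<nu> (Suc t))) sums (\<integral>s. V s \<partial>\<rho>)"
    by (simp add: \<nu>_def)
  from sums_diff[OF policy_value_sums[OF P \<rho>] this]
  show ?thesis
    unfolding \<mu>_def[symmetric] split by (simp only: policy_value_def[of _ _ _ _ Q] V_def)
qed

end

section \<open>Integration against the discounted occupancy\<close>

text \<open>The occupancy is the sum of the laws of the pairs at time \<open>t\<close> weighted by
  \<open>\<gamma> ^ t\<close>. This holds on sets by exchanging integral and series, and passes to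
  functions by induction over nonnegative measurable functions.\<close>

lemma nn_integral_occupancy:
  assumes \<rho>: "\<rho> \<in> space (prob_algebra borel)"
    and P: "P \<in> kernels A" and \<pi>: "\<pi> \<in> policies A"
    and f: "f \<in> borel_measurable (state_action A)"
  shows "(\<integral>\<^sup>+x. f x \<partial>occupancy \<gamma> A \<rho> P \<pi>) =
    (\<Sum>t. ennreal (\<gamma> ^ t) * (\<integral>\<^sup>+x. f x \<partial>(\<rho> \<bind> pair_law A P \<pi> t)))"
proof -
  let ?O = "occupancy \<gamma> A \<rho> P \<pi>" and ?\<mu> = "\<lambda>t. \<rho> \<bind> pair_law A P \<pi> t"
  have sets_O[measurable_cong]: "sets ?O = sets (state_action A)"
    by (simp add: occupancy_def sets.sigma_sets_eq)
  have sets_\<mu>[measurable_cong]: "sets (?\<mu> t) = sets (state_action A)" for t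
    by (rule sets_bind'[OF \<rho> measurable_pair_law[OF P \<pi>]])
  note space_O = sets_eq_imp_space_eq[OF sets_O] and space_\<mu> = sets_eq_imp_space_eq[OF sets_\<mu>]
  have meas: "g \<in> borel_measurable ?O" "g \<in> borel_measurable (?\<mu> t)"
    if "g \<in> borel_measurable (state_action A)" for g :: "_ \<Rightarrow> ennreal" and t
    using that by (simp_all only: measurable_cong_sets[OF sets_O refl] measurable_cong_sets[OF sets_\<mu> refl])
  interpret IT: Ionescu_Tulcea "step_law A \<rho> P \<pi>" "\<lambda>_. state_action A"
    using \<rho> P \<pi> by (intro Ionescu_Tulcea_step_law)
  let ?T = "trajectory A \<rho> P \<pi>"
  have sets_T: "sets ?T = sets (PiM UNIV (\<lambda>_. state_action A))"
    unfolding trajectory_def by (rule IT.PF.sets_lim)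
  have comp[measurable]: "(\<lambda>\<omega>. \<omega> t) \<in> ?T \<rightarrow>\<^sub>M state_action A" for t
    by (subst measurable_cong_sets[OF sets_T refl]) (auto intro!: measurable_component_singleton)
  show ?thesis
    using f
  proof induction
    case (cong f g)
    have "(\<integral>\<^sup>+x. f x \<partial>?O) = (\<integral>\<^sup>+x. g x \<partial>?O)"
      by (rule nn_integral_cong) (simp only: space_O cong)
    moreover have "(\<integral>\<^sup>+x. f x \<partial>?\<mu> t) = (\<integral>\<^sup>+x. g x \<partial>?\<mu> t)" for t
      by (rule nn_integral_cong) (simp only: space_\<mu> cong)
    ultimately show ?case by (simp only: cong)
  next
    case (set X)
    note X[measurable] = set
    have "(\<integral>\<^sup>+\<omega>. indicator X (\<omega> t) \<partial>?T) = emeasure (?\<mu> t) X" for t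
    proof -
      have "(\<integral>\<^sup>+\<omega>. indicator X (\<omega> t) \<partial>?T) =
          (\<integral>\<^sup>+x. indicator X x \<partial>distr ?T (state_action A) (\<lambda>\<omega>. \<omega> t))"
        by (rule nn_integral_distr[OF comp, symmetric]) simp
      then show ?thesis
        by (simp add: distr_trajectory[OF \<rho> P \<pi>] sets_\<mu>)
    qed
    then have "emeasure ?O X = (\<Sum>t. ennreal (\<gamma> ^ t) * emeasure (?\<mu> t) X)"
      by (simp add: emeasure_occupancy[OF \<rho> P \<pi> X] nn_integral_suminf nn_integral_cmult)
    then show ?case by (simp add: sets_O sets_\<mu>)
  next
    case (mult u c)
    show ?case
      by (simp only: nn_integral_cmult[OF meas(1)[OF mult(2)]] nn_integral_cmult[OF meas(2)[OF mult(2)]]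
          mult(4) mult.left_commute[of _ c] ennreal_suminf_cmult)
  next
    case (add u v)
    show ?case
      by (simp only: nn_integral_add[OF meas(1) meas(1)] nn_integral_add[OF meas(2) meas(2)] add
          suminf_add[OF summableI summableI] distrib_left)
  next
    case (seq U)
    have SUP_int: "(\<integral>\<^sup>+x. (SUP i. U i) x \<partial>M) = (SUP i. \<integral>\<^sup>+x. U i x \<partial>M)"
      if "\<And>i. U i \<in> borel_measurable M" for M
      unfolding SUP_apply by (rule nn_integral_monotone_convergence_SUP[OF \<open>incseq U\<close> that])
    \<comment> \<open>Monotonicity in \<open>i\<close> of every summand allows the supremum to be
      moved out of the series.\<close>
    have "incseq (\<lambda>i. ennreal (\<gamma> ^ t) * (\<integral>\<^sup>+x. U i x \<partial>?\<mu> t))" for t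
      using \<open>incseq U\<close> by (auto simp: incseq_def le_fun_def intro!: mult_left_mono nn_integral_mono)
    then show ?case
      by (simp only: SUP_int[OF meas(1)] SUP_int[OF meas(2)] seq SUP_mult_left_ennreal
          ennreal_suminf_SUP_eq)
  qed
qed

section \<open>Lipschitz functions and transport cost\<close>

text \<open>
  Dividing by \<open>L\<close> on the left keeps the scaling on a measurable integrand; the cost integrals on the
  right may be lower integrals, for which no such rule is available. For \<open>L = 0\<close> the left-hand side
  is \<open>0\<close> by convention.
\<close>

lemma integral_diff_le_wasserstein1:
  fixes f :: "'s::metric_space \<Rightarrow> real"
  assumes \<mu>: "prob_space \<mu>" and lip: "L-lipschitz_on UNIV f" and bounded: "\<And>x. \<bar>f x\<bar> \<le> C"
  shows "ennreal (\<bar>(\<integral>x. f x \<partial>\<mu>) - (\<integral>x. f x \<partial>\<nu>)\<bar> / L) \<le> wasserstein1 \<mu> \<nu>"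
  unfolding wasserstein1_def
proof (rule INF_greatest)
  fix \<kappa> assume \<kappa>: "\<kappa> \<in> couplings \<mu> \<nu>"
  have f[measurable]: "f \<in> borel_measurable borel"
    by (rule borel_measurable_continuous_onI[OF lipschitz_on_continuous_on[OF lip]])
  have L: "0 \<le> L" by (rule lipschitz_on_nonneg[OF lip])
  have sets_\<kappa>[measurable_cong]: "sets \<kappa> = sets (borel \<Otimes>\<^sub>M borel)"
    and fst_\<kappa>: "distr \<kappa> borel fst = \<mu>" and snd_\<kappa>: "distr \<kappa> borel snd = \<nu>"
    using \<kappa> by (auto simp: couplings_def)
  have [measurable]: "fst \<in> \<kappa> \<rightarrow>\<^sub>M borel" "snd \<in> \<kappa> \<rightarrow>\<^sub>M borel" by measurable
  \<comment> \<open>The total mass of a coupling is read off its first marginal.\<close>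
  interpret prob_space \<kappa>
    by (rule prob_space_distrD[where f = fst and N = borel]) (simp_all only: \<mu> fst_\<kappa>, measurable)
  \<comment> \<open>Integrability comes from the bound on \<open>f\<close>, as first moments may be
    infinite.\<close>
  have int: "integrable \<kappa> (\<lambda>z. f (fst z))" "integrable \<kappa> (\<lambda>z. f (snd z))"
    using bounded by (auto intro!: integrable_const_bound[where B = C])
  have "(\<integral>x. f x \<partial>\<mu>) - (\<integral>x. f x \<partial>\<nu>) = (\<integral>z. f (fst z) - f (snd z) \<partial>\<kappa>)"
    using int by (simp add: fst_\<kappa>[symmetric] snd_\<kappa>[symmetric] integral_distr)
  then have "((\<integral>x. f x \<partial>\<mu>) - (\<integral>x. f x \<partial>\<nu>)) / L = (\<integral>z. (f (fst z) - f (snd z)) / L \<partial>\<kappa>)"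
    by simp
  then have "\<bar>(\<integral>x. f x \<partial>\<mu>) - (\<integral>x. f x \<partial>\<nu>)\<bar> / L = \<bar>\<integral>z. (f (fst z) - f (snd z)) / L \<partial>\<kappa>\<bar>"
    using L by (metis abs_divide abs_of_nonneg)
  then have "ennreal (\<bar>(\<integral>x. f x \<partial>\<mu>) - (\<integral>x. f x \<partial>\<nu>)\<bar> / L)
      \<le> (\<integral>\<^sup>+z. ennreal (\<bar>f (fst z) - f (snd z)\<bar> / L) \<partial>\<kappa>)"
    using integral_norm_bound_ennreal[of \<kappa> "\<lambda>z. (f (fst z) - f (snd z)) / L"] int L
    by (simp only: real_norm_def abs_divide abs_of_nonneg Bochner_Integration.integrable_diff
        integrable_divide)
  also have "\<dots> \<le> (\<integral>\<^sup>+(x, y). ennreal (dist x y) \<partial>\<kappa>)"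
  proof (rule nn_integral_mono)
    fix z
    have "\<bar>f (fst z) - f (snd z)\<bar> / L \<le> dist (fst z) (snd z)"
      using lipschitz_onD[OF lip, of "fst z" "snd z"] L
      by (cases "L = 0") (simp_all add: dist_real_def divide_le_eq mult.commute)
    then show "ennreal (\<bar>f (fst z) - f (snd z)\<bar> / L) \<le> (case z of (x, y) \<Rightarrow> ennreal (dist x y))"
      by (simp add: case_prod_beta' ennreal_leI)
  qed
  finally show "ennreal (\<bar>(\<integral>x. f x \<partial>\<mu>) - (\<integral>x. f x \<partial>\<nu>)\<bar> / L)
      \<le> (\<integral>\<^sup>+(x, y). ennreal (dist x y) \<partial>\<kappa>)" .
qed

section \<open>From the telescoped series to the error value\<close>

text \<open>Taking absolute values term by term, and then inside each integral, turns the signed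
  series into nonnegative integrals, which the occupancy collects into one.\<close>

lemma (in bounded_policy_reward) policy_value_diff_le_occupancy:
  fixes P Q :: "('s, 'a) kernel"
  assumes \<rho>: "\<rho> \<in> space (prob_algebra borel)" and P: "P \<in> kernels A" and Q: "Q \<in> kernels A"
  defines "V \<equiv> state_value \<gamma> A r Q \<pi>"
  shows "ennreal \<bar>policy_value \<gamma> A \<rho> r P \<pi> - policy_value \<gamma> A \<rho> r Q \<pi>\<bar> \<le>
    ennreal \<gamma> * (\<integral>\<^sup>+x. ennreal \<bar>(\<integral>s. V s \<partial>P x) - (\<integral>s. V s \<partial>Q x)\<bar> \<partial>occupancy \<gamma> A \<rho> P \<pi>)"
proof -
  let ?C = "B / (1 - \<gamma>)"
  define \<delta> where "\<delta> x = (\<integral>s. V s \<partial>P x) - (\<integral>s. V s \<partial>Q x)" for x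
  define \<mu> where "\<mu> t = \<rho> \<bind> pair_law A P \<pi> t" for t
  have V: "V \<in> borel_measurable borel" "\<And>s. \<bar>V s\<bar> \<le> ?C"
    unfolding V_def by (rule measurable_state_value[OF Q], rule abs_state_value_le[OF Q])
  have \<mu>: "\<mu> t \<in> space (prob_algebra (state_action A))" for t
    unfolding \<mu>_def by (rule bind_pair_law_in_prob_algebra[OF P \<rho>])
  have \<delta>: "\<delta> \<in> borel_measurable (state_action A)"
    unfolding \<delta>_def[abs_def]
    using integral_measurable_prob_algebra[OF P V(1)] integral_measurable_prob_algebra[OF Q V(1)]
    by (rule borel_measurable_diff)
  have \<delta>_le: "\<bar>\<delta> x\<bar> \<le> 2 * ?C" if "x \<in> space (state_action A)" for x
    using abs_integral_le_prob_algebra[OF measurable_space[OF P that] V]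
      abs_integral_le_prob_algebra[OF measurable_space[OF Q that] V]
    unfolding \<delta>_def by linarith
  have sums: "(\<lambda>t. \<gamma> ^ Suc t * (\<integral>x. \<delta> x \<partial>\<mu> t)) sums
      (policy_value \<gamma> A \<rho> r P \<pi> - policy_value \<gamma> A \<rho> r Q \<pi>)" (is "?a sums ?D")
    unfolding \<delta>_def \<mu>_def V_def by (rule policy_value_diff_sums[OF \<rho> P Q])
  \<comment> \<open>Geometric decay makes the series absolutely convergent, which the triangle
    inequality and the passage to \<open>ennreal\<close> both use. The factor 2 counts the two
    kernel integrals in \<delta>.\<close>
  have a_le: "\<bar>?a t\<bar> \<le> \<gamma> ^ t * (\<gamma> * (2 * ?C))" for t
    using abs_integral_le_prob_algebra[OF \<mu> \<delta> \<delta>_le, of t] discount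
    by (simp add: abs_mult mult.assoc mult_left_mono del: times_divide_eq_right)
  have summable: "summable (\<lambda>t. \<bar>?a t\<bar>)"
    using a_le by (intro summable_comparison_test'[OF summable_discount[of "\<gamma> * (2 * ?C)"], of 0]) (simp only: real_norm_def abs_abs)
  have "\<bar>?D\<bar> \<le> (\<Sum>t. \<bar>?a t\<bar>)"
    using summable_rabs[OF summable] sums_unique[OF sums] by simp
  then have "ennreal \<bar>?D\<bar> \<le> (\<Sum>t. ennreal \<bar>?a t\<bar>)"
    using summable by (simp add: suminf_ennreal2 ennreal_leI)
  also have "\<dots> \<le> (\<Sum>t. ennreal \<gamma> * (ennreal (\<gamma> ^ t) * (\<integral>\<^sup>+x. ennreal \<bar>\<delta> x\<bar> \<partial>\<mu> t)))"
  proof (rule suminf_le[OF _ summableI summableI])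
    fix t
    have "ennreal \<bar>\<integral>x. \<delta> x \<partial>\<mu> t\<bar> \<le> (\<integral>\<^sup>+x. ennreal \<bar>\<delta> x\<bar> \<partial>\<mu> t)"
      using integral_norm_bound_ennreal[OF integrable_prob_algebra[OF \<mu> \<delta> \<delta>_le], of t] by simp
    from mult_left_mono[OF this, of "ennreal (\<gamma> ^ Suc t)"]
    show "ennreal \<bar>?a t\<bar> \<le> ennreal \<gamma> * (ennreal (\<gamma> ^ t) * (\<integral>\<^sup>+x. ennreal \<bar>\<delta> x\<bar> \<partial>\<mu> t))"
      using discount by (simp add: abs_mult ennreal_mult mult.assoc)
  qed
  also have "\<dots> = ennreal \<gamma> * (\<integral>\<^sup>+x. ennreal \<bar>\<delta> x\<bar> \<partial>occupancy \<gamma> A \<rho> P \<pi>)"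
    using \<delta> by (subst nn_integral_occupancy[OF \<rho> P policy]) (simp_all add: \<mu>_def)
  finally show ?thesis by (simp add: \<delta>_def)
qed

theorem theorem9:
  fixes A :: "'a measure"
    and P Phat :: "('s::metric_space, 'a) kernel"
    and r :: "'s \<times> 'a \<Rightarrow> real"
    and \<rho>\<^sub>0 :: "'s measure"
    and Pols :: "('s, 'a) policy set"
    and \<gamma> R_max L\<^sub>v :: real
  assumes discount: "0 < \<gamma>" "\<gamma> < 1"
    and initial: "\<rho>\<^sub>0 \<in> space (prob_algebra borel)"
    and true_kernel: "P \<in> kernels A"
    and simulator_kernel: "Phat \<in> kernels A"
    and reward_measurable: "r \<in> borel_measurable (state_action A)"
    and reward_bounds: "\<And>s a. a \<in> space A \<Longrightarrow> r (s, a) \<in> {0..R_max}"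
    and policy_class: "Pols \<subseteq> policies A"
    and value_lipschitz: "\<And>\<pi>. \<pi> \<in> Pols \<Longrightarrow> L\<^sub>v-lipschitz_on UNIV (state_value \<gamma> A r Phat \<pi>)"
  shows "(SUP \<pi>\<in>Pols. ennreal \<bar>policy_value \<gamma> A \<rho>\<^sub>0 r P \<pi> - policy_value \<gamma> A \<rho>\<^sub>0 r Phat \<pi>\<bar>)
    \<le> ennreal (\<gamma> * L\<^sub>v) * optimal_error_value \<gamma> A \<rho>\<^sub>0 P Phat Pols"
proof (rule SUP_least)
  fix \<pi> assume \<pi>: "\<pi> \<in> Pols"
  interpret bounded_policy_reward \<gamma> R_max A r \<pi>
  proof
    show "\<bar>r x\<bar> \<le> R_max" if "x \<in> space (state_action A)" for x
      using that reward_bounds[of "snd x" "fst x"] by (auto simp: space_pair_measure)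
  qed (rule discount reward_measurable subsetD[OF policy_class \<pi>])+
  define V where "V = state_value \<gamma> A r Phat \<pi>"
  define \<delta> where "\<delta> x = \<bar>(\<integral>s. V s \<partial>P x) - (\<integral>s. V s \<partial>Phat x)\<bar>" for x
  let ?O = "occupancy \<gamma> A \<rho>\<^sub>0 P \<pi>"
  have sets_O[measurable_cong]: "sets ?O = sets (state_action A)"
    by (simp add: occupancy_def sets.sigma_sets_eq)
  note space_O = sets_eq_imp_space_eq[OF sets_O]
  have lip: "L\<^sub>v-lipschitz_on UNIV V"
    unfolding V_def by (rule value_lipschitz[OF \<pi>])
  have L: "0 \<le> L\<^sub>v" by (rule lipschitz_on_nonneg[OF lip])
  have V: "V \<in> borel_measurable borel" "\<And>s. \<bar>V s\<bar> \<le> R_max / (1 - \<gamma>)"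
    unfolding V_def
    by (rule measurable_state_value[OF simulator_kernel], rule abs_state_value_le[OF simulator_kernel])
  have prob: "prob_space (K x)" if "K \<in> kernels A" "x \<in> space ?O" for K x
    using measurable_space[OF that(1)] that(2) by (simp add: space_prob_algebra space_O)
  have [measurable]: "\<delta> \<in> borel_measurable (state_action A)"
    unfolding \<delta>_def[abs_def]
    using integral_measurable_prob_algebra[OF true_kernel V(1)]
      integral_measurable_prob_algebra[OF simulator_kernel V(1)] by measurable
  \<comment> \<open>For \<open>L\<^sub>v = 0\<close> the right-hand side is 0 by the conventions for
    division, and in the final bound it is 0 even if the error value is infinite. So \<delta> has to
    vanish: \<open>V\<close> is constant, and both kernels have mass one.\<close>
  have \<delta>_eq: "\<delta> x = L\<^sub>v * (\<delta> x / L\<^sub>v)" if x: "x \<in> space ?O" for x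
  proof (cases "L\<^sub>v = 0")
    case True
    then have "V = (\<lambda>_. V undefined)"
      using lipschitz_onD[OF lip] by fastforce
    then obtain c where "V = (\<lambda>_. c)" by blast
    then show ?thesis
      using prob[OF true_kernel x] prob[OF simulator_kernel x]
      by (simp add: \<delta>_def prob_space.prob_space)
  qed simp
  have \<delta>_nonneg: "0 \<le> \<delta> x / L\<^sub>v" for x
    using L by (simp add: \<delta>_def)
  have "(\<integral>\<^sup>+x. ennreal (\<delta> x) \<partial>?O) = (\<integral>\<^sup>+x. ennreal L\<^sub>v * ennreal (\<delta> x / L\<^sub>v) \<partial>?O)"
    using \<delta>_eq L \<delta>_nonneg by (intro nn_integral_cong) (metis ennreal_mult)
  also have "\<dots> = ennreal L\<^sub>v * (\<integral>\<^sup>+x. ennreal (\<delta> x / L\<^sub>v) \<partial>?O)"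
    by (rule nn_integral_cmult) measurable
  \<comment> \<open>The pointwise comparison passes to the integrals by monotonicity, which holds
    for lower integrals too; hence the error reward may fail to be measurable.\<close>
  also have "\<dots> \<le> ennreal L\<^sub>v * error_value \<gamma> A \<rho>\<^sub>0 P Phat \<pi>"
    unfolding error_value_def error_reward_def \<delta>_def
    using integral_diff_le_wasserstein1[OF prob[OF true_kernel] lip V(2)]
    by (intro mult_left_mono nn_integral_mono) auto
  also have "\<dots> \<le> ennreal L\<^sub>v * optimal_error_value \<gamma> A \<rho>\<^sub>0 P Phat Pols"
    unfolding optimal_error_value_def using \<pi> by (intro mult_left_mono SUP_upper) auto
  finally have "ennreal \<gamma> * (\<integral>\<^sup>+x. ennreal (\<delta> x) \<partial>?O)
      \<le> ennreal \<gamma> * (ennreal L\<^sub>v * optimal_error_value \<gamma> A \<rho>\<^sub>0 P Phat Pols)"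
    by (rule mult_left_mono) simp
  then show "ennreal \<bar>policy_value \<gamma> A \<rho>\<^sub>0 r P \<pi> - policy_value \<gamma> A \<rho>\<^sub>0 r Phat \<pi>\<bar>
      \<le> ennreal (\<gamma> * L\<^sub>v) * optimal_error_value \<gamma> A \<rho>\<^sub>0 P Phat Pols"
    using policy_value_diff_le_occupancy[OF initial true_kernel simulator_kernel] discount L
    unfolding \<delta>_def V_def by (simp add: ennreal_mult mult.assoc)
qed

end
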